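(* For the system of partial differential equations (S) to have at least one $\mathbb R$-differentiable $(n-k_1,n-k_2)$-cylindricality first integral $F\colon z\mapsto F({}^kz)$ on $G'$ (of the form described in the context), it is necessary and sufficient that there exist a vector function ${}^\lambda\varphi=({}^{k_1}\varphi({}^kz),{}^{k_2}\varphi({}^kz))$ satisfying the functional system (E$_0$) and such that the function $F$ is a general integral of the Pfaffian equation (P).
   Context: Setting. $G\subset\mathbb C^n$ is a domain and $G'\subset G$ a subdomain. $\mathbb R$-differentiable means differentiable as a function of the real and imaginary parts of the variables (all higher derivatives that appear are assumed to exist); $\partial_{z_\xi},\partial_{\overline z_\xi}$ are Wirtinger derivatives. System (S) is the linear homogeneous system $$\mathfrak A_j(z)u=0,\ j=1,\dots,m,\qquad \mathfrak A_j(z)=\sum_{\xi=1}^n\bigl(u_{j\xi}(z)\partial_{z_\xi}+u_{j,n+\xi}(z)\partial_{\overline z_\xi}\bigr),\tag{S}$$ with $\mathbb R$-differentiable $u_{jp}\colon G\to\mathbb C$; the operators $\mathfrak A_1,\dots,\mathfrak A_m$ are not linearly bound on $G$ (operators are linearly bound on a domain if they are linearly dependent at every point of it). A (non-constant) $\mathbb R$-differentiable function $F\colon G'\to\mathbb C$ is a first integral of (S) if $\mathfrak A_jF=0$ on $G'$, $j=1,\dots,m$. Form of the functions. Fix $0\le k_1,k_2\le n$ and a permutation $(\zeta_1,\dots,\zeta_n)$ of $(1,\dots,n)$. An $(n-k_1,n-k_2)$-cylindricality function $F({}^kz)$ is an $\mathbb R$-differentiable function on $G'$ that is antiholomorphic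 in $z_{k_1+1},\dots,z_n$ and holomorphic in $z_{\zeta_{k_2+1}},\dots,z_{\zeta_n}$, i.e. $\partial_{z_\gamma}F=0$ for $\gamma>k_1$ and $\partial_{\overline z_{\zeta_\delta}}F=0$ for $\delta>k_2$. Notation. $\lambda=k_1+k_2$, ${}^\lambda u^j=(u_{j1},\dots,u_{jk_1},u_{j,n+\zeta_1},\dots,u_{j,n+\zeta_{k_2}})$. The unknowns are ${}^{k_1}\varphi=(\varphi^{(1)}_1,\dots,\varphi^{(1)}_{k_1})$, ${}^{k_2}\varphi=(\varphi^{(2)}_1,\dots,\varphi^{(2)}_{k_2})$ with components of the form $\cdot({}^kz)$, ${}^\lambda\varphi=({}^{k_1}\varphi,{}^{k_2}\varphi)$. With $a\cdot b=\sum a_ib_i$, system (E$_0$) on $G'$ is, for $j=1,\dots,m$, ${}^\lambda\varphi\cdot{}^\lambda u^j=0$; ${}^\lambda\varphi\cdot\partial_{z_\gamma}^l\,{}^\lambda u^j=0$, $l=1,\dots,\lambda-1$, $\gamma=k_1+1,\dots,n$; ${}^\lambda\varphi\cdot\partial_{\overline z_{\zeta_\delta}}^l\,{}^\lambda u^j=0$, $l=1,\dots,\lambda-1$, $\delta=k_2+1,\dots,n$. The Pfaffian equation is $$\omega:=\sum_{\xi=1}^{k_1}\varphi^{(1)}_\xi dz_\xi+\sum_{\tau=1}^{k_2}\varphi^{(2)}_\tau d\overline z_{\zeta_\tau}=0.\tag{P}$$ A (non-constant) function $F({}^kz)$ is a general integral of (P) if $\mu\,\omega=dF$ for some non-vanishing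 function $\mu({}^kz)$ (an integrating factor).
   Formalization: The first integral F is required to be twice ℝ-differentiable: the components of φ and the integrating factor μ are ℝ-differentiable, so dF = μω forces this, and the claim fails for a first integral that is differentiable only once. *)

theory Defs
  imports "HOL-Analysis.Analysis"
begin

text \<open>
  Points of the complex space of dimension \<open>n = CARD('n)\<close> have type \<open>complex ^ 'n\<close>.  As the
  coordinates are referred to by their numbers \<open>1, ..., n\<close>, a numbering
  \<open>e\<close> with \<open>bij_betw e {1..CARD('n)} UNIV\<close> is carried along: the coordinate
  \<open>z\<^sub>\<xi>\<close> is \<open>z $ e \<xi>\<close>.  All index ranges start at 1.
\<close>

definition is_domain :: "(complex ^ 'n::finite) set \<Rightarrow> bool" where
  "is_domain G \<longleftrightarrow> open G \<and> connected G \<and> G \<noteq> {}"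

text \<open>
  \<open>complex ^ 'n\<close> is a real normed space, so the Frechet derivative of the library is the real one,
  and \<open>R_differentiable 1\<close> is differentiability in the real and imaginary parts of
  the variables.  \<open>R_differentiable r\<close> is \<open>r\<close>-fold differentiability; no continuity of
  the top derivatives is required.
\<close>

primrec R_differentiable :: "nat \<Rightarrow> (complex ^ 'n::finite) set \<Rightarrow> (complex ^ 'n \<Rightarrow> complex) \<Rightarrow> bool"
where
  "R_differentiable 0 S f \<longleftrightarrow> True"
| "R_differentiable (Suc r) S f \<longleftrightarrow>
     (\<forall>z\<in>S. f differentiable (at z)) \<and>
     (\<forall>h. R_differentiable r S (\<lambda>z. frechet_derivative f (at z) h))"

text \<open>
  Wirtinger derivatives with respect to the coordinate \<open>i\<close>: the directions \<open>axis i 1\<close> and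
  \<open>axis i \<i>\<close> are those of the real and the imaginary part of that coordinate.
\<close>

definition wirtinger :: "'n::finite \<Rightarrow> (complex ^ 'n \<Rightarrow> complex) \<Rightarrow> complex ^ 'n \<Rightarrow> complex" where
  "wirtinger i f z =
     (frechet_derivative f (at z) (axis i 1) - \<i> * frechet_derivative f (at z) (axis i \<i>)) / 2"

definition wirtinger_bar :: "'n::finite \<Rightarrow> (complex ^ 'n \<Rightarrow> complex) \<Rightarrow> complex ^ 'n \<Rightarrow> complex" where
  "wirtinger_bar i f z =
     (frechet_derivative f (at z) (axis i 1) + \<i> * frechet_derivative f (at z) (axis i \<i>)) / 2"

text \<open>
  \<open>u j p\<close>, for \<open>1 \<le> j \<le> m\<close> and \<open>1 \<le> p \<le> 2 * n\<close>, are the coefficients of the operators.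
\<close>

definition op_A :: "(nat \<Rightarrow> 'n::finite) \<Rightarrow> (nat \<Rightarrow> nat \<Rightarrow> complex ^ 'n \<Rightarrow> complex) \<Rightarrow> nat
    \<Rightarrow> (complex ^ 'n \<Rightarrow> complex) \<Rightarrow> complex ^ 'n \<Rightarrow> complex" where
  "op_A e u j f z =
     (\<Sum>\<xi> = 1..CARD('n). u j \<xi> z * wirtinger (e \<xi>) f z
                        + u j (CARD('n) + \<xi>) z * wirtinger_bar (e \<xi>) f z)"

text \<open>
  Linear dependence of the operators at a point is linear dependence over the complex numbers of
  their coefficient vectors there.
\<close>

definition linearly_bound :: "(complex ^ 'n::finite) set \<Rightarrow> nat
    \<Rightarrow> (nat \<Rightarrow> nat \<Rightarrow> complex ^ 'n \<Rightarrow> complex) \<Rightarrow> bool" where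
  "linearly_bound G m u \<longleftrightarrow>
     (\<forall>z\<in>G. \<exists>c :: nat \<Rightarrow> complex.
        (\<exists>j\<in>{1..m}. c j \<noteq> 0) \<and>
        (\<forall>p\<in>{1..2 * CARD('n)}. (\<Sum>j = 1..m. c j * u j p z) = 0))"

definition first_integral :: "(nat \<Rightarrow> 'n::finite) \<Rightarrow> (complex ^ 'n) set \<Rightarrow> nat
    \<Rightarrow> (nat \<Rightarrow> nat \<Rightarrow> complex ^ 'n \<Rightarrow> complex) \<Rightarrow> (complex ^ 'n \<Rightarrow> complex) \<Rightarrow> bool" where
  "first_integral e G' m u F \<longleftrightarrow>
     R_differentiable 1 G' F \<and> \<not> F constant_on G' \<and>
     (\<forall>j\<in>{1..m}. \<forall>z\<in>G'. op_A e u j F z = 0)"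

definition cylindricality :: "(nat \<Rightarrow> 'n::finite) \<Rightarrow> nat \<Rightarrow> nat \<Rightarrow> (nat \<Rightarrow> nat) \<Rightarrow> (complex ^ 'n) set
    \<Rightarrow> (complex ^ 'n \<Rightarrow> complex) \<Rightarrow> bool" where
  "cylindricality e k1 k2 \<zeta> G' F \<longleftrightarrow>
     R_differentiable 1 G' F \<and>
     (\<forall>\<gamma>\<in>{k1 + 1..CARD('n)}. \<forall>z\<in>G'. wirtinger (e \<gamma>) F z = 0) \<and>
     (\<forall>\<delta>\<in>{k2 + 1..CARD('n)}. \<forall>z\<in>G'. wirtinger_bar (e (\<zeta> \<delta>)) F z = 0)"

text \<open>
  The vector of functions of length \<open>k1 + k2\<close> that lists \<open>a 1, ..., a k1, b 1, ..., b k2\<close>.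
\<close>

definition vec_join :: "nat \<Rightarrow> (nat \<Rightarrow> 'f) \<Rightarrow> (nat \<Rightarrow> 'f) \<Rightarrow> nat \<Rightarrow> 'f" where
  "vec_join k1 a b i = (if i \<le> k1 then a i else b (i - k1))"

definition lam_u :: "nat \<Rightarrow> (nat \<Rightarrow> nat) \<Rightarrow> (nat \<Rightarrow> nat \<Rightarrow> complex ^ 'n::finite \<Rightarrow> complex)
    \<Rightarrow> nat \<Rightarrow> nat \<Rightarrow> complex ^ 'n \<Rightarrow> complex" where
  "lam_u k1 \<zeta> u j = vec_join k1 (u j) (\<lambda>\<tau>. u j (CARD('n) + \<zeta> \<tau>))"

text \<open>
  The functional system for the unknowns \<open>\<phi>1 1, ..., \<phi>1 k1, \<phi>2 1, ..., \<phi>2 k2\<close>;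
  in case \<open>k1 + k2 = 0\<close> the truncated \<open>k1 + k2 - 1\<close> yields the intended empty range of \<open>l\<close>.
\<close>

definition functional_system :: "(nat \<Rightarrow> 'n::finite) \<Rightarrow> nat \<Rightarrow> nat \<Rightarrow> (nat \<Rightarrow> nat) \<Rightarrow> (complex ^ 'n) set
    \<Rightarrow> nat \<Rightarrow> (nat \<Rightarrow> nat \<Rightarrow> complex ^ 'n \<Rightarrow> complex)
    \<Rightarrow> (nat \<Rightarrow> complex ^ 'n \<Rightarrow> complex) \<Rightarrow> (nat \<Rightarrow> complex ^ 'n \<Rightarrow> complex) \<Rightarrow> bool" where
  "functional_system e k1 k2 \<zeta> G' m u \<phi>1 \<phi>2 \<longleftrightarrow>
     (\<forall>j\<in>{1..m}. \<forall>z\<in>G'.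
        (\<Sum>i = 1..k1 + k2. vec_join k1 \<phi>1 \<phi>2 i z * lam_u k1 \<zeta> u j i z) = 0 \<and>
        (\<forall>l\<in>{1..k1 + k2 - 1}. \<forall>\<gamma>\<in>{k1 + 1..CARD('n)}.
           (\<Sum>i = 1..k1 + k2. vec_join k1 \<phi>1 \<phi>2 i z
              * (wirtinger (e \<gamma>) ^^ l) (lam_u k1 \<zeta> u j i) z) = 0) \<and>
        (\<forall>l\<in>{1..k1 + k2 - 1}. \<forall>\<delta>\<in>{k2 + 1..CARD('n)}.
           (\<Sum>i = 1..k1 + k2. vec_join k1 \<phi>1 \<phi>2 i z
              * (wirtinger_bar (e (\<zeta> \<delta>)) ^^ l) (lam_u k1 \<zeta> u j i) z) = 0))"

text \<open>
  The differential form of the Pfaffian equation at the point \<open>z\<close>, evaluated at the tangent vector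
  \<open>h\<close>: \<open>dz\<^sub>\<xi>\<close> and its conjugate send \<open>h\<close> to \<open>h $ e \<xi>\<close> and \<open>cnj (h $ e \<xi>)\<close>.
\<close>

definition pfaff_form :: "(nat \<Rightarrow> 'n::finite) \<Rightarrow> nat \<Rightarrow> nat \<Rightarrow> (nat \<Rightarrow> nat)
    \<Rightarrow> (nat \<Rightarrow> complex ^ 'n \<Rightarrow> complex) \<Rightarrow> (nat \<Rightarrow> complex ^ 'n \<Rightarrow> complex)
    \<Rightarrow> complex ^ 'n \<Rightarrow> complex ^ 'n \<Rightarrow> complex" where
  "pfaff_form e k1 k2 \<zeta> \<phi>1 \<phi>2 z h =
     (\<Sum>\<xi> = 1..k1. \<phi>1 \<xi> z * h $ e \<xi>) + (\<Sum>\<tau> = 1..k2. \<phi>2 \<tau> z * cnj (h $ e (\<zeta> \<tau>)))"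

definition general_integral :: "(nat \<Rightarrow> 'n::finite) \<Rightarrow> nat \<Rightarrow> nat \<Rightarrow> (nat \<Rightarrow> nat) \<Rightarrow> (complex ^ 'n) set
    \<Rightarrow> (nat \<Rightarrow> complex ^ 'n \<Rightarrow> complex) \<Rightarrow> (nat \<Rightarrow> complex ^ 'n \<Rightarrow> complex)
    \<Rightarrow> (complex ^ 'n \<Rightarrow> complex) \<Rightarrow> bool" where
  "general_integral e k1 k2 \<zeta> G' \<phi>1 \<phi>2 F \<longleftrightarrow>
     cylindricality e k1 k2 \<zeta> G' F \<and> \<not> F constant_on G' \<and>
     (\<exists>\<mu>. cylindricality e k1 k2 \<zeta> G' \<mu> \<and> (\<forall>z\<in>G'. \<mu> z \<noteq> 0) \<and>
       (\<forall>z\<in>G'. (F has_derivative (\<lambda>h. \<mu> z * pfaff_form e k1 k2 \<zeta> \<phi>1 \<phi>2 z h)) (at z)))"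

text \<open>
  Differentiability of the first integral is required twice: the functions \<open>\<phi>\<close> belonging to it are
  its first derivatives up to a factor, and they are themselves to be differentiable.
\<close>

definition cyl_first_integral :: "(nat \<Rightarrow> 'n::finite) \<Rightarrow> nat \<Rightarrow> nat \<Rightarrow> (nat \<Rightarrow> nat) \<Rightarrow> (complex ^ 'n) set
    \<Rightarrow> nat \<Rightarrow> (nat \<Rightarrow> nat \<Rightarrow> complex ^ 'n \<Rightarrow> complex) \<Rightarrow> (complex ^ 'n \<Rightarrow> complex) \<Rightarrow> bool" where
  "cyl_first_integral e k1 k2 \<zeta> G' m u F \<longleftrightarrow>
     R_differentiable 2 G' F \<and> cylindricality e k1 k2 \<zeta> G' F \<and> first_integral e G' m u F"

definition cyl_vector :: "(nat \<Rightarrow> 'n::finite) \<Rightarrow> nat \<Rightarrow> nat \<Rightarrow> (nat \<Rightarrow> nat) \<Rightarrow> (complex ^ 'n) set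
    \<Rightarrow> (nat \<Rightarrow> complex ^ 'n \<Rightarrow> complex) \<Rightarrow> (nat \<Rightarrow> complex ^ 'n \<Rightarrow> complex) \<Rightarrow> bool" where
  "cyl_vector e k1 k2 \<zeta> G' \<phi>1 \<phi>2 \<longleftrightarrow>
     (\<forall>\<xi>\<in>{1..k1}. cylindricality e k1 k2 \<zeta> G' (\<phi>1 \<xi>)) \<and>
     (\<forall>\<tau>\<in>{1..k2}. cylindricality e k1 k2 \<zeta> G' (\<phi>2 \<tau>))"

end

theory Submission
  imports Defs
begin

text \<open>
  Cylindricality of \<open>F\<close> kills all Wirtinger derivatives of \<open>F\<close> except the \<open>k1 + k2\<close> of them that
  pair with the entries of \<open>lam_u\<close>.  Hence the differential of \<open>F\<close> is the Pfaffian form whose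
  coefficients are these derivatives (\<open>has_derivative_pfaff_form\<close>), and \<open>op_A\<close> applied to \<open>F\<close> is
  the first row of the functional system for the same coefficients (\<open>op_A_cylindricality\<close>).

  Necessity: take the remaining Wirtinger derivatives of \<open>F\<close> as \<open>\<phi>\<close>, with integrating factor 1.
  They are again cylindrical because Wirtinger operators commute on \<open>F\<close>: if an operator kills
  \<open>F\<close>, it kills every Wirtinger derivative of \<open>F\<close> (\<open>cylindricality_wirt\<close>).  The first row of the
  functional system is the differential equation itself; each of the other rows comes from the
  preceding one by applying an operator that treats \<open>\<phi>\<close> as a constant, so that by the product
  rule only the coefficients \<open>u\<close> are differentiated (\<open>annihilated_funpow_wirt\<close>).

  Sufficiency: in \<open>dF = \<mu> * \<omega>\<close> the coefficients of \<open>dz\<close> and of its conjugates are determined by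
  \<open>F\<close>, so the remaining Wirtinger derivatives of \<open>F\<close> are \<open>\<mu> * \<phi>\<close>, and \<open>op_A\<close> applied to \<open>F\<close> is \<open>\<mu>\<close>
  times the first row of the functional system.  The second derivatives of \<open>F\<close> exist because
  \<open>\<mu>\<close> and \<open>\<phi>\<close> are differentiable.

  The analytic point is the commutation of the operators.  Twofold differentiability does not
  make the second derivatives continuous, so the symmetry of second derivatives is proved in
  the form that only asks for differentiability of the first derivatives at one point.
\<close>

section \<open>Symmetry of second derivatives\<close>

text \<open>
  After division by \<open>t\<^sup>2\<close> the second difference tends to the derivative, in direction \<open>b\<close>, of the
  derivative in direction \<open>a\<close>.  As a function of \<open>s\<close> the increment
  \<open>f (x + s *\<^sub>R a + t *\<^sub>R b) - f (x + s *\<^sub>R a)\<close> has a derivative that differs from \<open>t *\<^sub>R A b\<close> by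
  at most \<open>\<epsilon> * t\<close>, since \<open>\<lambda>y. f' y a\<close> is close to its linearization at \<open>x\<close>; the mean value inequality
  on \<open>{0..t}\<close> then gives the second factor \<open>t\<close>.
\<close>

lemma second_difference_estimate:
  fixes f :: "'a::real_normed_vector \<Rightarrow> 'b::real_normed_vector"
  assumes "open S" "x \<in> S" "0 < \<epsilon>"
    and f': "\<And>y. y \<in> S \<Longrightarrow> (f has_derivative f' y) (at y)"
    and A: "((\<lambda>y. f' y a) has_derivative A) (at x)"
  shows "\<exists>d>0. \<forall>t. 0 < t \<and> t < d \<longrightarrow>
    norm (f (x + t *\<^sub>R a + t *\<^sub>R b) - f (x + t *\<^sub>R a) - f (x + t *\<^sub>R b) + f x - t\<^sup>2 *\<^sub>R A b)
      \<le> \<epsilon> * t\<^sup>2"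
proof -
  \<comment> \<open>All points that occur are at distance at most \<open>t * M\<close> from \<open>x\<close>; the summand 1 makes \<open>M\<close> positive
    also when both directions vanish.\<close>
  define M where "M = norm a + norm b + 1"
  have M: "M > 0" and Mab: "norm a + norm b \<le> M"
    unfolding M_def by (auto intro: add_nonneg_pos)
  interpret A: bounded_linear A
    using A by (rule has_derivative_bounded_linear)
  have "0 < \<epsilon> / (2 * M)"
    using M \<open>0 < \<epsilon>\<close> by simp
  \<comment> \<open>Two linearization errors enter, each with a distance of at most \<open>t * M\<close>, whence the factor
    \<open>2 * M\<close>.\<close>
  then obtain d1 where d1: "d1 > 0"
    "\<And>y. norm (y - x) < d1 \<Longrightarrow> norm (f' y a - f' x a - A (y - x)) \<le> \<epsilon> / (2 * M) * norm (y - x)"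
    using A unfolding has_derivative_at_alt by blast
  obtain r where r: "r > 0" "ball x r \<subseteq> S"
    using \<open>open S\<close> \<open>x \<in> S\<close> open_contains_ball by blast
  define d where "d = min d1 r / M"
  have "norm (f (x + t *\<^sub>R a + t *\<^sub>R b) - f (x + t *\<^sub>R a) - f (x + t *\<^sub>R b) + f x - t\<^sup>2 *\<^sub>R A b)
      \<le> \<epsilon> * t\<^sup>2" if t: "0 < t" "t < d" for t
  proof -
    have tM: "t * M < d1" "t * M < r"
      using t M unfolding d_def by (simp_all add: field_simps)
    define \<psi> where "\<psi> s = f (x + s *\<^sub>R a + t *\<^sub>R b) - f (x + s *\<^sub>R a) - s *\<^sub>R t *\<^sub>R A b" for s
    define \<psi>' where "\<psi>' s = f' (x + s *\<^sub>R a + t *\<^sub>R b) a - f' (x + s *\<^sub>R a) a - t *\<^sub>R A b" for s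
    have near: "norm (s *\<^sub>R a + q *\<^sub>R b) \<le> t * M" if "s \<in> {0..t}" "q \<in> {0..t}" for s q
    proof -
      have "norm (s *\<^sub>R a + q *\<^sub>R b) \<le> s * norm a + q * norm b"
        using that by (intro norm_triangle_le) auto
      also have "\<dots> \<le> t * norm a + t * norm b"
        using that by (intro add_mono mult_right_mono) auto
      also have "\<dots> \<le> t * M"
        using t Mab by (simp flip: distrib_left)
      finally show ?thesis .
    qed
    have inS: "x + s *\<^sub>R a + q *\<^sub>R b \<in> S" if "s \<in> {0..t}" "q \<in> {0..t}" for s q
    proof -
      have "x + s *\<^sub>R a + q *\<^sub>R b \<in> ball x r"
        using near[OF that] tM norm_minus_cancel[of "s *\<^sub>R a + q *\<^sub>R b"] by (simp add: dist_norm add.assoc)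
      then show ?thesis
        using r(2) by blast
    qed
    have lin: "norm (f' (x + s *\<^sub>R a + q *\<^sub>R b) a - f' x a - A (s *\<^sub>R a + q *\<^sub>R b)) \<le> \<epsilon> / 2 * t"
      if "s \<in> {0..t}" "q \<in> {0..t}" for s q
    proof -
      have "norm (f' (x + s *\<^sub>R a + q *\<^sub>R b) a - f' x a - A (s *\<^sub>R a + q *\<^sub>R b))
          \<le> \<epsilon> / (2 * M) * norm (s *\<^sub>R a + q *\<^sub>R b)"
        using d1(2)[of "x + s *\<^sub>R a + q *\<^sub>R b"] near[OF that] tM by (simp add: add.assoc)
      also have "\<dots> \<le> \<epsilon> / (2 * M) * (t * M)"
        using near[OF that] M \<open>0 < \<epsilon>\<close> by (intro mult_left_mono) auto
      finally show ?thesis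
        using M by simp
    qed
    have der: "(\<psi> has_derivative (\<lambda>h. h *\<^sub>R \<psi>' s)) (at s within {0..t})" if s: "s \<in> {0..t}" for s
    proof -
      have 1: "((\<lambda>s. f (x + s *\<^sub>R a + q *\<^sub>R b)) has_derivative (\<lambda>h. f' (x + s *\<^sub>R a + q *\<^sub>R b) (h *\<^sub>R a)))
        (at s within {0..t})" if "q \<in> {0..t}" for q
        by (rule has_derivative_compose[of "\<lambda>s. x + s *\<^sub>R a + q *\<^sub>R b" _ _ _ f,
              OF _ f'[OF inS[OF s that]]])
          (auto intro!: derivative_eq_intros)
      have sc: "f' (x + s *\<^sub>R a + q *\<^sub>R b) (h *\<^sub>R a) = h *\<^sub>R f' (x + s *\<^sub>R a + q *\<^sub>R b) a"
        if "q \<in> {0..t}" for q h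
        using f'[OF inS[OF s that]] by (simp add: has_derivative_linear linear_cmul)
      show ?thesis
        unfolding \<psi>_def \<psi>'_def
        using 1[of t] 1[of 0] sc[of t] sc[of 0] t
        by (auto intro!: derivative_eq_intros simp: algebra_simps)
    qed
    have bnd: "onorm (\<lambda>h. h *\<^sub>R \<psi>' s) \<le> \<epsilon> * t" if s: "s \<in> {0..t}" for s
    proof (rule onorm_bound)
      have "\<psi>' s = (f' (x + s *\<^sub>R a + t *\<^sub>R b) a - f' x a - A (s *\<^sub>R a + t *\<^sub>R b))
          - (f' (x + s *\<^sub>R a + 0 *\<^sub>R b) a - f' x a - A (s *\<^sub>R a + 0 *\<^sub>R b))"
        by (simp add: \<psi>'_def A.add A.scaleR)
      also have "norm \<dots> \<le> \<epsilon> / 2 * t + \<epsilon> / 2 * t"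
        using t s by (intro order_trans[OF norm_triangle_ineq4 add_mono] lin) auto
      finally have "norm (\<psi>' s) \<le> \<epsilon> * t"
        by simp
      then show "norm (h *\<^sub>R \<psi>' s) \<le> \<epsilon> * t * norm h" for h
        using mult_left_mono[of "norm (\<psi>' s)" "\<epsilon> * t" "\<bar>h\<bar>"] by (simp add: ac_simps)
    qed (use t \<open>0 < \<epsilon>\<close> in auto)
    have "norm (\<psi> t - \<psi> 0) \<le> \<epsilon> * t * norm (t - 0)"
      by (rule differentiable_bound[OF convex_real_interval(5) der bnd]) (use t in auto)
    then show ?thesis
      using t by (simp add: \<psi>_def power2_eq_square algebra_simps)
  qed
  moreover have "d > 0"
    using d1 r M by (simp add: d_def)
  ultimately show ?thesis
    by blast
qed

text \<open>
  The second difference is symmetric in \<open>a\<close> and \<open>b\<close>, so both mixed derivatives are the limit of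
  the same quotient.
\<close>

lemma second_derivative_symmetric:
  fixes f :: "'a::real_normed_vector \<Rightarrow> 'b::real_normed_vector"
  assumes "open S" "x \<in> S"
    and f': "\<And>y. y \<in> S \<Longrightarrow> (f has_derivative f' y) (at y)"
    and A: "((\<lambda>y. f' y a) has_derivative A) (at x)"
    and B: "((\<lambda>y. f' y b) has_derivative B) (at x)"
  shows "A b = B a"
proof (rule ccontr)
  assume "A b \<noteq> B a"
  \<comment> \<open>Each estimate costs one \<open>\<epsilon>\<close>, so any fraction below one half yields the contradiction.\<close>
  define \<epsilon> where "\<epsilon> = norm (A b - B a) / 3"
  have \<epsilon>: "\<epsilon> > 0"
    using \<open>A b \<noteq> B a\<close> by (simp add: \<epsilon>_def)
  obtain d1 where d1: "d1 > 0" "\<And>t. 0 < t \<Longrightarrow> t < d1 \<Longrightarrow>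
    norm (f (x + t *\<^sub>R a + t *\<^sub>R b) - f (x + t *\<^sub>R a) - f (x + t *\<^sub>R b) + f x - t\<^sup>2 *\<^sub>R A b)
      \<le> \<epsilon> * t\<^sup>2"
    using second_difference_estimate[OF assms(1,2) \<epsilon> f' A, of b] by blast
  obtain d2 where d2: "d2 > 0" "\<And>t. 0 < t \<Longrightarrow> t < d2 \<Longrightarrow>
    norm (f (x + t *\<^sub>R b + t *\<^sub>R a) - f (x + t *\<^sub>R b) - f (x + t *\<^sub>R a) + f x - t\<^sup>2 *\<^sub>R B a)
      \<le> \<epsilon> * t\<^sup>2"
    using second_difference_estimate[OF assms(1,2) \<epsilon> f' B, of a] by blast
  define t where "t = min d1 d2 / 2"
  have t: "0 < t" "t < d1" "t < d2"
    using d1(1) d2(1) by (auto simp: t_def)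
  define \<Delta> where "\<Delta> = f (x + t *\<^sub>R a + t *\<^sub>R b) - f (x + t *\<^sub>R a) - f (x + t *\<^sub>R b) + f x"
  have "norm (\<Delta> - t\<^sup>2 *\<^sub>R A b) \<le> \<epsilon> * t\<^sup>2"
    using d1(2) t by (simp add: \<Delta>_def)
  moreover have "norm (\<Delta> - t\<^sup>2 *\<^sub>R B a) \<le> \<epsilon> * t\<^sup>2"
    using d2(2)[OF t(1,3)] by (simp add: \<Delta>_def algebra_simps)
  ultimately have "norm ((\<Delta> - t\<^sup>2 *\<^sub>R B a) - (\<Delta> - t\<^sup>2 *\<^sub>R A b)) \<le> \<epsilon> * t\<^sup>2 + \<epsilon> * t\<^sup>2"
    by (meson add_mono norm_triangle_ineq4 order_trans)
  also have "(\<Delta> - t\<^sup>2 *\<^sub>R B a) - (\<Delta> - t\<^sup>2 *\<^sub>R A b) = t\<^sup>2 *\<^sub>R (A b - B a)"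
    by (simp add: algebra_simps)
  finally have "3 * \<epsilon> * t\<^sup>2 \<le> 2 * \<epsilon> * t\<^sup>2"
    by (simp add: \<epsilon>_def mult.commute)
  then show False
    using \<epsilon> t by simp
qed

section \<open>Repeated real differentiability\<close>

lemma frechet_derivative_cong_open:
  assumes "open S" "z \<in> S" "\<And>w. w \<in> S \<Longrightarrow> f w = g w"
  shows "frechet_derivative f (at z) = frechet_derivative g (at z)"
proof -
  have "(f has_derivative D) (at z) \<longleftrightarrow> (g has_derivative D) (at z)" for D
    using assms has_derivative_transform_within_open[of _ D z UNIV S] by (auto; metis)
  then show ?thesis
    by (simp add: frechet_derivative_def)
qed

lemma differentiable_cong_open:
  assumes "open S" "z \<in> S" "\<And>w. w \<in> S \<Longrightarrow> f w = g w" "f differentiable (at z)"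
  shows "g differentiable (at z)"
  using assms has_derivative_transform_within_open unfolding differentiable_def by metis

lemma R_differentiable_cong:
  assumes "open S"
  shows "(\<And>z. z \<in> S \<Longrightarrow> f z = g z) \<Longrightarrow> R_differentiable r S f \<Longrightarrow> R_differentiable r S g"
proof (induction r arbitrary: f g)
  case (Suc r)
  have "R_differentiable r S (\<lambda>z. frechet_derivative g (at z) h)" for h
  proof (rule Suc.IH)
    show "frechet_derivative f (at z) h = frechet_derivative g (at z) h" if "z \<in> S" for z
      by (rule fun_cong[OF frechet_derivative_cong_open[OF assms that Suc.prems(1)]])
    show "R_differentiable r S (\<lambda>z. frechet_derivative f (at z) h)"
      using Suc.prems(2) by simp
  qed
  moreover have "g differentiable (at z)" if "z \<in> S" for z
    using Suc.prems(2) that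
    by (intro differentiable_cong_open[OF assms that Suc.prems(1)]) auto
  ultimately show ?case
    by simp
qed simp

lemma R_differentiable_mono:
  "R_differentiable r S f \<Longrightarrow> T \<subseteq> S \<Longrightarrow> q \<le> r \<Longrightarrow> R_differentiable q T f"
proof (induction r arbitrary: f q)
  case (Suc r)
  then show ?case
    by (cases q) auto
qed simp

lemma R_differentiable_lincomb:
  assumes "open S"
  shows "R_differentiable r S f \<Longrightarrow> R_differentiable r S g \<Longrightarrow>
    R_differentiable r S (\<lambda>z. a * f z + b * g z)"
proof (induction r arbitrary: f g)
  case (Suc r)
  have der: "((\<lambda>z. a * f z + b * g z) has_derivative
      (\<lambda>h. a * frechet_derivative f (at z) h + b * frechet_derivative g (at z) h)) (at z)"
    if "z \<in> S" for z
    using Suc.prems that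
    by (intro has_derivative_add has_derivative_mult_right)
      (auto simp: frechet_derivative_works[symmetric])
  have "R_differentiable r S (\<lambda>z. frechet_derivative (\<lambda>z. a * f z + b * g z) (at z) h)" for h
  proof (rule R_differentiable_cong[OF assms])
    show "R_differentiable r S
        (\<lambda>z. a * frechet_derivative f (at z) h + b * frechet_derivative g (at z) h)"
      using Suc.prems by (intro Suc.IH) auto
    show "a * frechet_derivative f (at z) h + b * frechet_derivative g (at z) h =
        frechet_derivative (\<lambda>z. a * f z + b * g z) (at z) h" if "z \<in> S" for z
      using fun_cong[OF frechet_derivative_at[OF der[OF that]], of h] .
  qed
  moreover have "(\<lambda>z. a * f z + b * g z) differentiable (at z)" if "z \<in> S" for z
    using der[OF that] by (rule differentiableI)
  ultimately show ?case
    by simp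
qed simp

section \<open>Wirtinger operators\<close>

text \<open>
  The two kinds of Wirtinger derivatives differ only in a scalar, which is \<open>- \<i>\<close> for the derivative
  and \<open>\<i>\<close> for the conjugate one.  As a parameter \<open>c\<close> it lets one lemma serve both kinds,
  and also the mixed case of a commutator of one with the other.
\<close>

definition wirt :: "complex \<Rightarrow> 'n::finite \<Rightarrow> (complex ^ 'n \<Rightarrow> complex) \<Rightarrow> complex ^ 'n \<Rightarrow> complex" where
  "wirt c i f z =
     (frechet_derivative f (at z) (axis i 1) + c * frechet_derivative f (at z) (axis i \<i>)) / 2"

lemma wirtinger_eq_wirt: "wirtinger = wirt (- \<i>)" and wirtinger_bar_eq_wirt: "wirtinger_bar = wirt \<i>"
  by (auto simp: fun_eq_iff wirt_def wirtinger_def wirtinger_bar_def)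

lemma wirt_cong_open:
  assumes "open S" "z \<in> S" "\<And>w. w \<in> S \<Longrightarrow> f w = g w"
  shows "wirt c i f z = wirt c i g z"
  using frechet_derivative_cong_open[OF assms] by (simp add: wirt_def)

lemma wirt_eqI:
  assumes "(f has_derivative D) (at z)"
  shows "wirt c i f z = (D (axis i 1) + c * D (axis i \<i>)) / 2"
  using frechet_derivative_at[OF assms] by (simp add: wirt_def)

lemma R_differentiable_wirt:
  assumes "open S" "R_differentiable (Suc r) S f"
  shows "R_differentiable r S (wirt c i f)"
proof -
  have "R_differentiable r S (\<lambda>z. 1/2 * frechet_derivative f (at z) (axis i 1)
      + c / 2 * frechet_derivative f (at z) (axis i \<i>))"
    using assms by (intro R_differentiable_lincomb) auto
  then show ?thesis
    by (rule R_differentiable_cong[OF assms(1), rotated]) (simp add: wirt_def field_simps)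
qed

lemma R_differentiable_funpow_wirt:
  assumes "open S" "R_differentiable (r + l) S f"
  shows "R_differentiable r S ((wirt c i ^^ l) f)"
  using assms(2)
proof (induction l arbitrary: r)
  case (Suc l)
  then have "R_differentiable (Suc r) S ((wirt c i ^^ l) f)"
    using Suc.IH[of "Suc r"] by simp
  then show ?case
    using R_differentiable_wirt[OF assms(1)] by (simp del: R_differentiable.simps)
qed simp

text \<open>
  A composition of two Wirtinger operators is a complex combination of four second directional
  derivatives, each of which is symmetric.
\<close>

lemma wirt_commute:
  assumes "open S" "R_differentiable 2 S f" "z \<in> S"
  shows "wirt c i (wirt d j f) z = wirt d j (wirt c i f) z"
proof -
  let ?D = "\<lambda>h f z. frechet_derivative f (at z) h"
  have f: "(f has_derivative frechet_derivative f (at w)) (at w)" if "w \<in> S" for w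
    using assms that by (simp add: numeral_2_eq_2 frechet_derivative_works[symmetric])
  have f': "(?D h f has_derivative frechet_derivative (?D h f) (at z)) (at z)" for h
    using assms by (simp add: numeral_2_eq_2 frechet_derivative_works[symmetric])
  have sym: "?D k (?D h f) z = ?D h (?D k f) z" for h k
    by (rule second_derivative_symmetric[OF assms(1,3) f f' f'])
  have exp: "wirt b k (wirt a h f) z =
      ((?D (axis k 1) (?D (axis h 1) f) z + a * ?D (axis k 1) (?D (axis h \<i>) f) z) / 2
      + b * ((?D (axis k \<i>) (?D (axis h 1) f) z + a * ?D (axis k \<i>) (?D (axis h \<i>) f) z) / 2)) / 2"
    for a b h k
  proof (rule wirt_eqI)
    show "(wirt a h f has_derivative
        (\<lambda>v. (?D v (?D (axis h 1) f) z + a * ?D v (?D (axis h \<i>) f) z) / 2)) (at z)"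
      unfolding wirt_def[abs_def] divide_inverse mult.commute[of _ "inverse 2"]
      by (intro has_derivative_mult_right has_derivative_add f')
  qed
  show ?thesis
    unfolding exp by (simp add: sym[of "axis i _" "axis j _"] field_simps)
qed

lemma wirt_sum_mult:
  fixes p q :: "'k \<Rightarrow> complex ^ 'n::finite \<Rightarrow> complex"
  assumes "\<And>k. k \<in> K \<Longrightarrow> p k differentiable (at z)" "\<And>k. k \<in> K \<Longrightarrow> q k differentiable (at z)"
  shows "wirt c i (\<lambda>z. \<Sum>k\<in>K. p k z * q k z) z =
    (\<Sum>k\<in>K. wirt c i (p k) z * q k z) + (\<Sum>k\<in>K. p k z * wirt c i (q k) z)"
proof -
  have "((\<lambda>z. \<Sum>k\<in>K. p k z * q k z) has_derivative (\<lambda>h. \<Sum>k\<in>K.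
      p k z * frechet_derivative (q k) (at z) h + frechet_derivative (p k) (at z) h * q k z)) (at z)"
    using assms by (intro has_derivative_sum has_derivative_mult)
      (auto simp: frechet_derivative_works[symmetric])
  note wirt_eqI[OF this]
  also have "((\<Sum>k\<in>K. p k z * frechet_derivative (q k) (at z) (axis i 1)
        + frechet_derivative (p k) (at z) (axis i 1) * q k z)
      + c * (\<Sum>k\<in>K. p k z * frechet_derivative (q k) (at z) (axis i \<i>)
        + frechet_derivative (p k) (at z) (axis i \<i>) * q k z)) / 2
      = (\<Sum>k\<in>K. wirt c i (p k) z * q k z + p k z * wirt c i (q k) z)"
    unfolding sum_distrib_left sum.distrib[symmetric] sum_divide_distrib
    by (intro sum.cong refl) (simp add: wirt_def field_simps)
  finally show ?thesis
    by (simp only: sum.distrib)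
qed

text \<open>
  If the operator kills all \<open>p k\<close>, it acts on \<open>\<Sum>k\<in>K. p k z * q k z\<close> as if the \<open>p k\<close> were
  constants; applied again and again to the zero function it gives the rows of
  higher order of the functional system.
\<close>

lemma annihilated_funpow_wirt:
  fixes p q :: "'k \<Rightarrow> complex ^ 'n::finite \<Rightarrow> complex"
  assumes "open S"
    and p: "\<And>k z. k \<in> K \<Longrightarrow> z \<in> S \<Longrightarrow> p k differentiable (at z)"
    and wp: "\<And>k z. k \<in> K \<Longrightarrow> z \<in> S \<Longrightarrow> wirt c i (p k) z = 0"
    and q: "\<And>k. k \<in> K \<Longrightarrow> R_differentiable r S (q k)"
    and pq: "\<And>z. z \<in> S \<Longrightarrow> (\<Sum>k\<in>K. p k z * q k z) = 0"
  shows "l \<le> r \<Longrightarrow> z \<in> S \<Longrightarrow> (\<Sum>k\<in>K. p k z * (wirt c i ^^ l) (q k) z) = 0"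
proof (induction l arbitrary: z)
  case 0
  then show ?case
    using pq by simp
next
  case (Suc l)
  have "(wirt c i ^^ l) (q k) differentiable (at z)" if "k \<in> K" for k
    using R_differentiable_funpow_wirt[OF assms(1), of 1 l "q k"] Suc.prems
      R_differentiable_mono[OF q[OF that], of S "1 + l"] by simp
  then have "wirt c i (\<lambda>z. \<Sum>k\<in>K. p k z * (wirt c i ^^ l) (q k) z) z =
      (\<Sum>k\<in>K. p k z * (wirt c i ^^ Suc l) (q k) z)"
    using Suc.prems p wp by (subst wirt_sum_mult) auto
  moreover have "wirt c i (\<lambda>z. \<Sum>k\<in>K. p k z * (wirt c i ^^ l) (q k) z) z = wirt c i (\<lambda>z. 0) z"
    using Suc by (intro wirt_cong_open[OF assms(1)]) auto
  moreover have "wirt c i (\<lambda>z. 0) z = 0"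
    by (subst wirt_eqI[OF has_derivative_const]) simp
  ultimately show ?case
    by simp
qed

section \<open>The differential in the coordinates that remain\<close>

text \<open>
  A real-linear functional on complex vectors splits into a complex-linear and an antilinear part,
  whose coefficients are the Wirtinger coefficients.
\<close>

lemma linear_wirtinger_form:
  fixes L :: "complex ^ 'n::finite \<Rightarrow> complex"
  assumes "linear L"
  shows "L h = (\<Sum>i\<in>UNIV. (L (axis i 1) - \<i> * L (axis i \<i>)) / 2 * h $ i
    + (L (axis i 1) + \<i> * L (axis i \<i>)) / 2 * cnj (h $ i))"
proof -
  have "h = (\<Sum>i\<in>UNIV. Re (h $ i) *\<^sub>R axis i 1 + Im (h $ i) *\<^sub>R axis i \<i>)"
    by (auto simp: vec_eq_iff axis_def complex_eq_iff if_distrib if_distribR sum.If_cases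
        cong: if_cong)
  then have "L h = L (\<Sum>i\<in>UNIV. Re (h $ i) *\<^sub>R axis i 1 + Im (h $ i) *\<^sub>R axis i \<i>)"
    by simp
  also have "\<dots> = (\<Sum>i\<in>UNIV. Re (h $ i) *\<^sub>R L (axis i 1) + Im (h $ i) *\<^sub>R L (axis i \<i>))"
    by (simp add: linear_sum[OF assms] linear_add[OF assms] linear_cmul[OF assms])
  also have "\<dots> = (\<Sum>i\<in>UNIV. (L (axis i 1) - \<i> * L (axis i \<i>)) / 2 * h $ i
    + (L (axis i 1) + \<i> * L (axis i \<i>)) / 2 * cnj (h $ i))"
    by (intro sum.cong refl) (simp add: complex_eq_iff field_simps)
  finally show ?thesis .
qed

lemma sum_vec_join:
  "(\<Sum>i = 1..k1 + k2. H (vec_join k1 a b i) (vec_join k1 c d i)) =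
    (\<Sum>i = 1..k1. H (a i) (c i)) + (\<Sum>i = 1..k2. H (b i) (d i))"
proof -
  have "(\<Sum>i = 1..k1 + k2. H (vec_join k1 a b i) (vec_join k1 c d i)) =
      (\<Sum>i = 1..k1. H (vec_join k1 a b i) (vec_join k1 c d i))
      + (\<Sum>i = k1 + 1..k1 + k2. H (vec_join k1 a b i) (vec_join k1 c d i))"
    by (rule sum.ub_add_nat) simp
  also have "(\<Sum>i = k1 + 1..k1 + k2. H (vec_join k1 a b i) (vec_join k1 c d i)) =
      (\<Sum>i = 1..k2. H (vec_join k1 a b (k1 + i)) (vec_join k1 c d (k1 + i)))"
    by (rule sum.reindex_bij_witness[of _ "\<lambda>i. k1 + i" "\<lambda>i. i - k1"]) auto
  finally show ?thesis
    by (simp add: vec_join_def)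
qed

lemma sum_truncate:
  fixes g :: "nat \<Rightarrow> 'a::comm_monoid_add"
  assumes "k \<le> n" "\<And>i. i \<in> {k + 1..n} \<Longrightarrow> g i = 0"
  shows "sum g {1..n} = sum g {1..k}"
  using assms by (intro sum.mono_neutral_right) auto

locale cyl_coordinates =
  fixes e :: "nat \<Rightarrow> 'n::finite" and k1 k2 :: nat and \<zeta> :: "nat \<Rightarrow> nat"
  assumes e: "bij_betw e {1..CARD('n)} UNIV"
    and k1: "k1 \<le> CARD('n)" and k2: "k2 \<le> CARD('n)"
    and \<zeta>: "\<zeta> permutes {1..CARD('n)}"
begin

lemma \<zeta>_mem: "\<tau> \<in> {1..k2} \<Longrightarrow> \<zeta> \<tau> \<in> {1..CARD('n)}"
  using permutes_in_image[OF \<zeta>, of \<tau>] k2 by auto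

lemma op_A_cylindricality:
  assumes "cylindricality e k1 k2 \<zeta> S F" "z \<in> S"
  shows "op_A e u j F z = (\<Sum>i = 1..k1 + k2.
    vec_join k1 (\<lambda>\<xi>. wirtinger (e \<xi>) F) (\<lambda>\<tau>. wirtinger_bar (e (\<zeta> \<tau>)) F) i z * lam_u k1 \<zeta> u j i z)"
proof -
  have "op_A e u j F z = (\<Sum>\<xi> = 1..CARD('n). u j \<xi> z * wirtinger (e \<xi>) F z)
      + (\<Sum>\<xi> = 1..CARD('n). u j (CARD('n) + \<xi>) z * wirtinger_bar (e \<xi>) F z)"
    by (simp add: op_A_def sum.distrib)
  also have "(\<Sum>\<xi> = 1..CARD('n). u j (CARD('n) + \<xi>) z * wirtinger_bar (e \<xi>) F z) =
      (\<Sum>\<xi> = 1..CARD('n). u j (CARD('n) + \<zeta> \<xi>) z * wirtinger_bar (e (\<zeta> \<xi>)) F z)"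
    by (rule sum.reindex_bij_betw[OF permutes_imp_bij[OF \<zeta>], symmetric])
  also have "\<dots> = (\<Sum>\<xi> = 1..k2. u j (CARD('n) + \<zeta> \<xi>) z * wirtinger_bar (e (\<zeta> \<xi>)) F z)"
    using assms by (intro sum_truncate k2) (auto simp: cylindricality_def)
  also have "(\<Sum>\<xi> = 1..CARD('n). u j \<xi> z * wirtinger (e \<xi>) F z) =
      (\<Sum>\<xi> = 1..k1. u j \<xi> z * wirtinger (e \<xi>) F z)"
    using assms by (intro sum_truncate k1) (auto simp: cylindricality_def)
  finally show ?thesis
    unfolding lam_u_def sum_vec_join[where H = "\<lambda>f g. f z * g z"] by (simp add: mult.commute)
qed

lemma has_derivative_pfaff_form:
  assumes "cylindricality e k1 k2 \<zeta> S F" "z \<in> S"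
  shows "(F has_derivative
    pfaff_form e k1 k2 \<zeta> (\<lambda>\<xi>. wirtinger (e \<xi>) F) (\<lambda>\<tau>. wirtinger_bar (e (\<zeta> \<tau>)) F) z) (at z)"
proof -
  let ?L = "frechet_derivative F (at z)"
  have L: "(F has_derivative ?L) (at z)"
    using assms by (simp add: cylindricality_def frechet_derivative_works[symmetric])
  have "?L h = pfaff_form e k1 k2 \<zeta> (\<lambda>\<xi>. wirtinger (e \<xi>) F) (\<lambda>\<tau>. wirtinger_bar (e (\<zeta> \<tau>)) F) z h"
    for h
  proof -
    have "?L h = (\<Sum>i\<in>UNIV. wirtinger i F z * h $ i) + (\<Sum>i\<in>UNIV. wirtinger_bar i F z * cnj (h $ i))"
      by (subst linear_wirtinger_form[OF has_derivative_linear[OF L]])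
        (simp add: wirtinger_def wirtinger_bar_def sum.distrib)
    also have "(\<Sum>i\<in>UNIV. wirtinger i F z * h $ i) =
        (\<Sum>\<xi> = 1..CARD('n). wirtinger (e \<xi>) F z * h $ e \<xi>)"
      by (rule sum.reindex_bij_betw[OF e, symmetric])
    also have "\<dots> = (\<Sum>\<xi> = 1..k1. wirtinger (e \<xi>) F z * h $ e \<xi>)"
      using assms by (intro sum_truncate k1) (auto simp: cylindricality_def)
    also have "(\<Sum>i\<in>UNIV. wirtinger_bar i F z * cnj (h $ i)) =
        (\<Sum>\<tau> = 1..CARD('n). wirtinger_bar (e (\<zeta> \<tau>)) F z * cnj (h $ e (\<zeta> \<tau>)))"
      using sum.reindex_bij_betw[OF bij_betw_trans[OF permutes_imp_bij[OF \<zeta>] e], symmetric]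
      by (simp add: o_def)
    also have "\<dots> = (\<Sum>\<tau> = 1..k2. wirtinger_bar (e (\<zeta> \<tau>)) F z * cnj (h $ e (\<zeta> \<tau>)))"
      using assms by (intro sum_truncate k2) (auto simp: cylindricality_def)
    finally show ?thesis
      by (simp add: pfaff_form_def)
  qed
  then show ?thesis
    using L by (metis (no_types, lifting) ext)
qed

lemma pfaff_form_axis:
  "pfaff_form e k1 k2 \<zeta> a b z (axis i x) =
    (\<Sum>\<xi> | \<xi> \<in> {1..k1} \<and> e \<xi> = i. a \<xi> z) * x
    + (\<Sum>\<tau> | \<tau> \<in> {1..k2} \<and> e (\<zeta> \<tau>) = i. b \<tau> z) * cnj x"
proof -
  have "(\<Sum>\<xi> = 1..k1. a \<xi> z * axis i x $ e \<xi>) = (\<Sum>\<xi> | \<xi> \<in> {1..k1} \<and> e \<xi> = i. a \<xi> z) * x"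
    unfolding sum_distrib_right sum.inter_filter[OF finite_atLeastAtMost]
    by (intro sum.cong refl) (auto simp: axis_def)
  moreover have "(\<Sum>\<tau> = 1..k2. b \<tau> z * cnj (axis i x $ e (\<zeta> \<tau>))) =
      (\<Sum>\<tau> | \<tau> \<in> {1..k2} \<and> e (\<zeta> \<tau>) = i. b \<tau> z) * cnj x"
    unfolding sum_distrib_right sum.inter_filter[OF finite_atLeastAtMost]
    by (intro sum.cong refl) (auto simp: axis_def)
  ultimately show ?thesis
    by (simp add: pfaff_form_def)
qed

text \<open>
  This is the uniqueness of the coefficients of a form in the \<open>dz\<close> and their conjugates: a Wirtinger
  coefficient picks exactly one of them, since the numbering of the coordinates is injective.
\<close>

lemma wirtinger_pfaff_form:
  assumes "(F has_derivative (\<lambda>h. \<mu> * pfaff_form e k1 k2 \<zeta> a b z h)) (at z)"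
  shows "\<xi> \<in> {1..k1} \<Longrightarrow> wirtinger (e \<xi>) F z = \<mu> * a \<xi> z"
    and "\<tau> \<in> {1..k2} \<Longrightarrow> wirtinger_bar (e (\<zeta> \<tau>)) F z = \<mu> * b \<tau> z"
proof -
  have inj: "e i = e j \<longleftrightarrow> i = j" if "i \<in> {1..CARD('n)}" "j \<in> {1..CARD('n)}" for i j
    using e that by (auto simp: bij_betw_def dest: inj_onD)
  have inj\<zeta>: "\<zeta> i = \<zeta> j \<longleftrightarrow> i = j" for i j
    using permutes_inj[OF \<zeta>] by (auto dest: injD)
  show "wirtinger (e \<xi>) F z = \<mu> * a \<xi> z" if \<xi>: "\<xi> \<in> {1..k1}"
  proof -
    have "{\<xi>'. \<xi>' \<in> {1..k1} \<and> e \<xi>' = e \<xi>} = {\<xi>}"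
      using \<xi> k1 inj[of _ \<xi>] by auto
    then show ?thesis
      by (simp add: wirtinger_eq_wirt wirt_eqI[OF assms] pfaff_form_axis algebra_simps
          del: atLeastAtMost_iff)
  qed
  show "wirtinger_bar (e (\<zeta> \<tau>)) F z = \<mu> * b \<tau> z" if \<tau>: "\<tau> \<in> {1..k2}"
  proof -
    have "{\<tau>'. \<tau>' \<in> {1..k2} \<and> e (\<zeta> \<tau>') = e (\<zeta> \<tau>)} = {\<tau>}"
      using \<tau> inj[OF \<zeta>_mem \<zeta>_mem] inj\<zeta> by blast
    then show ?thesis
      by (simp add: wirtinger_bar_eq_wirt wirt_eqI[OF assms] pfaff_form_axis algebra_simps
          del: atLeastAtMost_iff)
  qed
qed

section \<open>Necessity and sufficiency\<close>

lemma cylindricality_wirt: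
  assumes "open S" "R_differentiable 2 S F" "cylindricality e k1 k2 \<zeta> S F"
  shows "cylindricality e k1 k2 \<zeta> S (wirt c i F)"
proof -
  have "wirt d j (wirt c i F) z = 0" if z: "z \<in> S" and 0: "\<And>w. w \<in> S \<Longrightarrow> wirt d j F w = 0" for d j z
  proof -
    have "wirt d j (wirt c i F) z = wirt c i (wirt d j F) z"
      by (rule wirt_commute[OF assms(1,2) z])
    also have "\<dots> = wirt c i (\<lambda>w. 0) z"
      using 0 by (intro wirt_cong_open[OF assms(1) z])
    also have "\<dots> = 0"
      by (subst wirt_eqI[OF has_derivative_const]) simp
    finally show ?thesis .
  qed
  moreover have "R_differentiable 1 S (wirt c i F)"
    using R_differentiable_wirt[OF assms(1), of 1 F] assms(2) by (simp add: numeral_2_eq_2)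
  ultimately show ?thesis
    using assms(3) unfolding cylindricality_def wirtinger_eq_wirt wirtinger_bar_eq_wirt by blast
qed

text \<open>
  For a cylindrical \<open>\<phi>\<close> the first row of the functional system already implies the rows of higher
  order; this is where the differentiability of order \<open>k1 + k2 - 1\<close> of the coefficients enters.
\<close>

lemma functional_systemI:
  assumes "open S" "cyl_vector e k1 k2 \<zeta> S \<phi>1 \<phi>2"
    and u: "\<And>j p. j \<in> {1..m} \<Longrightarrow> p \<in> {1..2 * CARD('n)} \<Longrightarrow> R_differentiable (k1 + k2 - 1) S (u j p)"
    and 0: "\<And>j z. j \<in> {1..m} \<Longrightarrow> z \<in> S \<Longrightarrow>
      (\<Sum>i = 1..k1 + k2. vec_join k1 \<phi>1 \<phi>2 i z * lam_u k1 \<zeta> u j i z) = 0"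
  shows "functional_system e k1 k2 \<zeta> S m u \<phi>1 \<phi>2"
proof -
  have \<phi>: "cylindricality e k1 k2 \<zeta> S (vec_join k1 \<phi>1 \<phi>2 i)" if "i \<in> {1..k1 + k2}" for i
  proof (cases "i \<le> k1")
    case False
    then have "i - k1 \<in> {1..k2}"
      using that by auto
    then show ?thesis
      using assms(2) False by (simp add: cyl_vector_def vec_join_def)
  qed (use assms(2) that in \<open>simp add: cyl_vector_def vec_join_def\<close>)
  have lam: "R_differentiable (k1 + k2 - 1) S (lam_u k1 \<zeta> u j i)"
    if "j \<in> {1..m}" "i \<in> {1..k1 + k2}" for i j
  proof (cases "i \<le> k1")
    case True
    then have "i \<in> {1..2 * CARD('n)}"
      using that k1 by auto
    then show ?thesis
      using u[OF that(1)] True by (simp add: lam_u_def vec_join_def)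
  next
    case False
    then have "\<zeta> (i - k1) \<in> {1..CARD('n)}"
      using that by (intro \<zeta>_mem) auto
    then have "CARD('n) + \<zeta> (i - k1) \<in> {1..2 * CARD('n)}"
      by auto
    then show ?thesis
      using u[OF that(1)] False by (simp add: lam_u_def vec_join_def)
  qed
  have "(\<Sum>i = 1..k1 + k2. vec_join k1 \<phi>1 \<phi>2 i z * (wirt c p ^^ l) (lam_u k1 \<zeta> u j i) z) = 0"
    if "j \<in> {1..m}" "z \<in> S" "l \<in> {1..k1 + k2 - 1}"
      "\<And>i w. i \<in> {1..k1 + k2} \<Longrightarrow> w \<in> S \<Longrightarrow> wirt c p (vec_join k1 \<phi>1 \<phi>2 i) w = 0" for c p l j z
    using that \<phi> lam 0
    by (intro annihilated_funpow_wirt[OF assms(1), where r = "k1 + k2 - 1"])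
      (auto simp: cylindricality_def)
  then show ?thesis
    using 0 \<phi> unfolding functional_system_def cylindricality_def wirtinger_eq_wirt wirtinger_bar_eq_wirt
    by blast
qed

lemma general_integral_of_first_integral:
  assumes "open S"
    and u: "\<And>j p. j \<in> {1..m} \<Longrightarrow> p \<in> {1..2 * CARD('n)} \<Longrightarrow> R_differentiable (k1 + k2 - 1) S (u j p)"
    and F: "cyl_first_integral e k1 k2 \<zeta> S m u F"
  defines "\<phi>1 \<equiv> \<lambda>\<xi>. wirtinger (e \<xi>) F" and "\<phi>2 \<equiv> \<lambda>\<tau>. wirtinger_bar (e (\<zeta> \<tau>)) F"
  shows "cyl_vector e k1 k2 \<zeta> S \<phi>1 \<phi>2"
    and "functional_system e k1 k2 \<zeta> S m u \<phi>1 \<phi>2"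
    and "general_integral e k1 k2 \<zeta> S \<phi>1 \<phi>2 F"
proof -
  have cyl: "cylindricality e k1 k2 \<zeta> S F" and F2: "R_differentiable 2 S F"
    and fi: "first_integral e S m u F"
    using F by (auto simp: cyl_first_integral_def)
  show \<phi>: "cyl_vector e k1 k2 \<zeta> S \<phi>1 \<phi>2"
    using cylindricality_wirt[OF assms(1) F2 cyl]
    by (simp add: cyl_vector_def \<phi>1_def \<phi>2_def wirtinger_eq_wirt wirtinger_bar_eq_wirt)
  show "functional_system e k1 k2 \<zeta> S m u \<phi>1 \<phi>2"
    using fi op_A_cylindricality[OF cyl, where u = u]
    by (intro functional_systemI[OF assms(1) \<phi> u]) (auto simp: first_integral_def \<phi>1_def \<phi>2_def)
  have one: "((\<lambda>z. 1) has_derivative (\<lambda>h. 0)) (at z)" for z :: "complex ^ 'n"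
    by simp
  have "cylindricality e k1 k2 \<zeta> S (\<lambda>z. 1)"
    by (simp add: cylindricality_def wirtinger_eq_wirt wirtinger_bar_eq_wirt wirt_eqI[OF one])
  moreover have "(F has_derivative (\<lambda>h. 1 * pfaff_form e k1 k2 \<zeta> \<phi>1 \<phi>2 z h)) (at z)" if "z \<in> S" for z
    using has_derivative_pfaff_form[OF cyl that] by (simp add: \<phi>1_def \<phi>2_def)
  ultimately show "general_integral e k1 k2 \<zeta> S \<phi>1 \<phi>2 F"
    using cyl fi unfolding general_integral_def first_integral_def
    by (auto intro!: exI[of _ "\<lambda>z. 1"])
qed

lemma first_integral_of_general_integral:
  assumes "open S"
    and \<phi>: "cyl_vector e k1 k2 \<zeta> S \<phi>1 \<phi>2"
    and sys: "functional_system e k1 k2 \<zeta> S m u \<phi>1 \<phi>2"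
    and F: "general_integral e k1 k2 \<zeta> S \<phi>1 \<phi>2 F"
  shows "cyl_first_integral e k1 k2 \<zeta> S m u F"
proof -
  obtain \<mu> where cyl: "cylindricality e k1 k2 \<zeta> S F" and nc: "\<not> F constant_on S"
    and \<mu>: "cylindricality e k1 k2 \<zeta> S \<mu>"
    and der: "\<And>z. z \<in> S \<Longrightarrow> (F has_derivative (\<lambda>h. \<mu> z * pfaff_form e k1 k2 \<zeta> \<phi>1 \<phi>2 z h)) (at z)"
    using F unfolding general_integral_def by blast
  have "(\<lambda>z. frechet_derivative F (at z) h) differentiable (at z)" if z: "z \<in> S" for z h
  proof (rule differentiable_cong_open[OF assms(1) z])
    show "\<mu> w * pfaff_form e k1 k2 \<zeta> \<phi>1 \<phi>2 w h = frechet_derivative F (at w) h" if "w \<in> S" for w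
      using fun_cong[OF frechet_derivative_at[OF der[OF that]], of h] .
    show "(\<lambda>w. \<mu> w * pfaff_form e k1 k2 \<zeta> \<phi>1 \<phi>2 w h) differentiable at z"
      using \<mu> \<phi> z unfolding pfaff_form_def cyl_vector_def cylindricality_def
      by (intro differentiable_mult differentiable_add differentiable_sum) auto
  qed
  then have "R_differentiable 2 S F"
    using der by (auto simp: numeral_2_eq_2 differentiable_def)
  moreover have "op_A e u j F z = 0" if "j \<in> {1..m}" "z \<in> S" for j z
  proof -
    have "op_A e u j F z =
        (\<Sum>i = 1..k1 + k2. \<mu> z * (vec_join k1 \<phi>1 \<phi>2 i z * lam_u k1 \<zeta> u j i z))"
      unfolding op_A_cylindricality[OF cyl that(2)]
    proof (rule sum.cong[OF refl])
      fix i assume i: "i \<in> {1..k1 + k2}"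
      have "vec_join k1 (\<lambda>\<xi>. wirtinger (e \<xi>) F) (\<lambda>\<tau>. wirtinger_bar (e (\<zeta> \<tau>)) F) i z
          = \<mu> z * vec_join k1 \<phi>1 \<phi>2 i z"
      proof (cases "i \<le> k1")
        case True
        then show ?thesis
          using i wirtinger_pfaff_form(1)[OF der[OF that(2)], of i] by (simp add: vec_join_def)
      next
        case False
        then have "i - k1 \<in> {1..k2}"
          using i by auto
        then show ?thesis
          using False wirtinger_pfaff_form(2)[OF der[OF that(2)], of "i - k1"]
          by (simp add: vec_join_def)
      qed
      then show "vec_join k1 (\<lambda>\<xi>. wirtinger (e \<xi>) F) (\<lambda>\<tau>. wirtinger_bar (e (\<zeta> \<tau>)) F) i z
          * lam_u k1 \<zeta> u j i z = \<mu> z * (vec_join k1 \<phi>1 \<phi>2 i z * lam_u k1 \<zeta> u j i z)"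
        by simp
    qed
    also have "\<dots> = 0"
      using sys that by (simp add: functional_system_def flip: sum_distrib_left)
    finally show ?thesis .
  qed
  ultimately show ?thesis
    using cyl nc by (auto simp: cyl_first_integral_def first_integral_def cylindricality_def)
qed

end

theorem theorem2p5:
  fixes e :: "nat \<Rightarrow> 'n::finite"
    and G G' :: "(complex ^ 'n) set"
    and m k1 k2 :: nat
    and \<zeta> :: "nat \<Rightarrow> nat"
    and u :: "nat \<Rightarrow> nat \<Rightarrow> complex ^ 'n \<Rightarrow> complex"
  assumes "bij_betw e {1..CARD('n)} UNIV"
    and "is_domain G" and "is_domain G'" and "G' \<subseteq> G"
    and "1 \<le> m"
    and "k1 \<le> CARD('n)" and "k2 \<le> CARD('n)"
    and "\<zeta> permutes {1..CARD('n)}"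
    and "\<And>j p. j \<in> {1..m} \<Longrightarrow> p \<in> {1..2 * CARD('n)} \<Longrightarrow>
           R_differentiable (max 1 (k1 + k2 - 1)) G (u j p)"
    and "\<not> linearly_bound G m u"
  shows "((\<exists>F. cyl_first_integral e k1 k2 \<zeta> G' m u F) \<longleftrightarrow>
          (\<exists>\<phi>1 \<phi>2 F. cyl_vector e k1 k2 \<zeta> G' \<phi>1 \<phi>2 \<and>
             functional_system e k1 k2 \<zeta> G' m u \<phi>1 \<phi>2 \<and>
             general_integral e k1 k2 \<zeta> G' \<phi>1 \<phi>2 F)) \<and>
         (\<forall>F. cyl_first_integral e k1 k2 \<zeta> G' m u F \<longleftrightarrow>
          (\<exists>\<phi>1 \<phi>2. cyl_vector e k1 k2 \<zeta> G' \<phi>1 \<phi>2 \<and>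
             functional_system e k1 k2 \<zeta> G' m u \<phi>1 \<phi>2 \<and>
             general_integral e k1 k2 \<zeta> G' \<phi>1 \<phi>2 F))"
proof -
  interpret cyl_coordinates e k1 k2 \<zeta>
    using assms by unfold_locales auto
  have S: "open G'"
    using assms(3) by (simp add: is_domain_def)
  have u: "R_differentiable (k1 + k2 - 1) G' (u j p)" if "j \<in> {1..m}" "p \<in> {1..2 * CARD('n)}" for j p
    using R_differentiable_mono[OF assms(9)[OF that] assms(4)] by simp
  have "cyl_first_integral e k1 k2 \<zeta> G' m u F \<longleftrightarrow>
      (\<exists>\<phi>1 \<phi>2. cyl_vector e k1 k2 \<zeta> G' \<phi>1 \<phi>2 \<and>
         functional_system e k1 k2 \<zeta> G' m u \<phi>1 \<phi>2 \<and>
         general_integral e k1 k2 \<zeta> G' \<phi>1 \<phi>2 F)" for F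
  proof
    assume "cyl_first_integral e k1 k2 \<zeta> G' m u F"
    from general_integral_of_first_integral[where u = u, OF S u this]
    show "\<exists>\<phi>1 \<phi>2. cyl_vector e k1 k2 \<zeta> G' \<phi>1 \<phi>2 \<and> functional_system e k1 k2 \<zeta> G' m u \<phi>1 \<phi>2 \<and>
        general_integral e k1 k2 \<zeta> G' \<phi>1 \<phi>2 F"
      by blast
  qed (use first_integral_of_general_integral[OF S] in blast)
  then show ?thesis
    by blast
qed

end
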